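(* Let $m\in\{1,2,3,4\}$, let $c>0$, $\Delta x>0$, $\Delta y>0$, and let $M$ be the $4(m+1)^2\times 4(m+1)^2$ compatibility boundary condition (CBC) matrix (defined in the context) on a Cartesian grid with spacings $\Delta x,\Delta y$, for any one of the following cases: a Dirichlet side (D), a Neumann side (N), a Dirichlet-Dirichlet corner (D-D), a Neumann-Neumann corner (N-N), or a Dirichlet-Neumann corner (D-N). Then $M$ is nonsingular. Furthermore, for each such $m$ and each case, the max-norm condition number $\kappa_\infty$ of the row-scaled matrix $M$ depends only on the ratio $\gamma=\Delta x/\Delta y$ (and hence remains unchanged as the mesh is refined with $\gamma$ fixed).
   Context: The setting is the wave equation $\partial_t^2u=Lu$ with $L=c^2(\partial_x^2+\partial_y^2)$. At a boundary grid point $(x_i,y_j)$ of a Cartesian grid, the numerical solution is represented by a polynomial $$\bar u(x,y)=\sum_{l_1=0}^{2m+1}\sum_{l_2=0}^{2m+1}\bar u_{l_1,l_2}X^{l_1}Y^{l_2},\qquad X=\frac{x-x_i}{\Delta x},\quad Y=\frac{y-y_j}{\Delta y},$$ with $4(m+1)^2$ unknown coefficients $\bar u_{l_1,l_2}$. These are determined by a square linear system $M\bar{\mathbf u}=\mathbf b$, where $\bar{\mathbf u}$ is the vector of the $\bar u_{l_1,l_2}$ and $\mathbf b$ contains given data (interior data and boundary data). Each row of $M$ is the coefficient row (with respect to the unknowns $\bar u_{l_1,l_2}$) of one of the linear functionals of $\bar u$ listed below. The order of rows and of unknowns is immaterial. **Sides.** Consider a boundary point on the side $x=0$ that is not a corner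 (so $x_i=0$), with the domain in $x>0$. The rows are: (i) The $2(m+1)^2$ interpolation (matching) functionals $$\sum_{l_1=\alpha}^{2m+1}\sum_{l_2=\beta}^{2m+1}\binom{l_1}{\alpha}\binom{l_2}{\beta}\Big(\tfrac12\Big)^{l_1-\alpha}\Big(\pm\tfrac12\Big)^{l_2-\beta}\bar u_{l_1,l_2},\qquad \alpha,\beta=0,\dots,m,$$ for both choices of sign. These are the scaled derivatives $\frac{\Delta x^\alpha\Delta y^\beta}{\alpha!\,\beta!}\partial_x^\alpha\partial_y^\beta\bar u$ at $(x_i+\Delta x/2,\;y_j\pm\Delta y/2)$. (ii) The $2(m+1)^2$ CBC functionals, for $q=0,\dots,m$ and $\alpha=0,\dots,2m+1$: - Dirichlet: $\partial_y^\alpha L^q\bar u(0,y_j)$. - Neumann: $\partial_y^\alpha\partial_xL^q\bar u(0,y_j)$. **Corners.** Consider the corner $(x_i,y_j)=(0,0)$, with the domain in $x>0$, $y>0$. The rows are: (i) The $(m+1)^2$ matching functionals $$\sum_{l_1=\alpha}^{2m+1}\sum_{l_2=\beta}^{2m+1}\binom{l_1}{\alpha}\binom{l_2}{\beta}\Big(\tfrac12\Big)^{l_1-\alpha}\Big(\tfrac12\Big)^{l_2-\beta}\bar u_{l_1,l_2},\qquad \alpha,\beta=0,\dots,m.$$ (ii) $3(m+1)^2$ CBC functionals, for $q=0,\dots,m$. Define $$\mathcal M_q=\{0,1,\dots,2m+1\}\setminus\{0,2,4,\dots,2(q-1)\},\qquad \mathcal N_q=\{0,1,\dots,2m+1\}\setminus\{1,3,5,\dots,2q-1\},$$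 where the removed set is empty for $q=0$. All functionals below are evaluated at $(0,0)$. - D-D: $\partial_x^\alpha L^q\bar u$ and $\partial_y^\alpha L^q\bar u$ for $\alpha\in\mathcal M_q$, except that for $\alpha=2q$ these two functionals are replaced by the single functional that is their average. - N-N: $\partial_x^\alpha\partial_yL^q\bar u$ and $\partial_y^\alpha\partial_xL^q\bar u$ for $\alpha\in\mathcal N_q$, except that for $\alpha=2q+1$ these two functionals are replaced by their average. - D-N (Neumann on $y=0$, Dirichlet on $x=0$): $\partial_x^\alpha\partial_yL^q\bar u$ for $\alpha\in\mathcal M_q$ and $\partial_y^\beta L^q\bar u$ for $\beta\in\mathcal N_q$, except that the two functionals with $\alpha=2q$ and $\beta=2q+1$ are replaced by their average. The systems at other sides and corners are obtained by reflecting and/or interchanging $x$ and $y$; without loss of generality the cases above are considered. **Row scaling and condition number.** The row-scaled $M$ is obtained by dividing each row by its largest entry in absolute value. The condition number is $\kappa_\infty(M)=\|M\|_\infty\|M^{-1}\|_\infty$, where $\|\cdot\|_\infty$ is the maximum row sum of absolute values of the entries. *)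

theory Defs
  imports
    "HOL-Analysis.Derivative"
    "Jordan_Normal_Form.Gauss_Jordan_Elimination"
begin

definition partial_x :: "(real \<Rightarrow> real \<Rightarrow> real) \<Rightarrow> real \<Rightarrow> real \<Rightarrow> real" where
  "partial_x f = (\<lambda>x y. deriv (\<lambda>s. f s y) x)"

definition partial_y :: "(real \<Rightarrow> real \<Rightarrow> real) \<Rightarrow> real \<Rightarrow> real \<Rightarrow> real" where
  "partial_y f = (\<lambda>x y. deriv (\<lambda>s. f x s) y)"

definition wave_op :: "real \<Rightarrow> (real \<Rightarrow> real \<Rightarrow> real) \<Rightarrow> real \<Rightarrow> real \<Rightarrow> real" where
  "wave_op c f = (\<lambda>x y. c\<^sup>2 * ((partial_x ^^ 2) f x y + (partial_y ^^ 2) f x y))"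

type_synonym coeffs = "nat \<Rightarrow> nat \<Rightarrow> real"

definition grid_poly ::
  "nat \<Rightarrow> real \<Rightarrow> real \<Rightarrow> real \<Rightarrow> real \<Rightarrow> coeffs \<Rightarrow> real \<Rightarrow> real \<Rightarrow> real" where
  "grid_poly m dx dy xi yj u = (\<lambda>x y. \<Sum>l1=0..2*m+1. \<Sum>l2=0..2*m+1.
     u l1 l2 * ((x - xi) / dx) ^ l1 * ((y - yj) / dy) ^ l2)"

text \<open>
  The functionals below act on the array of polynomial coefficients; only the entries with
  both indices at most \<open>2 * m + 1\<close> matter.
\<close>

type_synonym functional = "coeffs \<Rightarrow> real"

text \<open>The sign \<open>\<plusminus>\<close> of the offset in \<open>y\<close> is the argument \<open>s\<close>, which is \<open>1\<close> or \<open>-1\<close>.\<close>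

definition matching :: "nat \<Rightarrow> real \<Rightarrow> nat \<Rightarrow> nat \<Rightarrow> functional" where
  "matching m s \<alpha> \<beta> = (\<lambda>u. \<Sum>l1=\<alpha>..2*m+1. \<Sum>l2=\<beta>..2*m+1.
     real (l1 choose \<alpha>) * real (l2 choose \<beta>) * (1/2) ^ (l1 - \<alpha>) * (s * (1/2)) ^ (l2 - \<beta>) * u l1 l2)"

definition matching_list :: "nat \<Rightarrow> real \<Rightarrow> functional list" where
  "matching_list m s = [matching m s \<alpha> \<beta>. \<alpha> \<leftarrow> [0..<m+1], \<beta> \<leftarrow> [0..<m+1]]"

definition average :: "functional \<Rightarrow> functional \<Rightarrow> functional" where
  "average F G = (\<lambda>u. (F u + G u) / 2)"

definition dirichlet_side ::
  "nat \<Rightarrow> real \<Rightarrow> real \<Rightarrow> real \<Rightarrow> real \<Rightarrow> nat \<Rightarrow> nat \<Rightarrow> functional" where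
  "dirichlet_side m c dx dy yj \<alpha> q = (\<lambda>u.
     (partial_y ^^ \<alpha>) ((wave_op c ^^ q) (grid_poly m dx dy 0 yj u)) 0 yj)"

definition neumann_side ::
  "nat \<Rightarrow> real \<Rightarrow> real \<Rightarrow> real \<Rightarrow> real \<Rightarrow> nat \<Rightarrow> nat \<Rightarrow> functional" where
  "neumann_side m c dx dy yj \<alpha> q = (\<lambda>u.
     (partial_y ^^ \<alpha>) (partial_x ((wave_op c ^^ q) (grid_poly m dx dy 0 yj u))) 0 yj)"

definition corner_dx :: "nat \<Rightarrow> real \<Rightarrow> real \<Rightarrow> real \<Rightarrow> nat \<Rightarrow> nat \<Rightarrow> functional" where
  "corner_dx m c dx dy \<alpha> q = (\<lambda>u.
     (partial_x ^^ \<alpha>) ((wave_op c ^^ q) (grid_poly m dx dy 0 0 u)) 0 0)"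

definition corner_dy :: "nat \<Rightarrow> real \<Rightarrow> real \<Rightarrow> real \<Rightarrow> nat \<Rightarrow> nat \<Rightarrow> functional" where
  "corner_dy m c dx dy \<alpha> q = (\<lambda>u.
     (partial_y ^^ \<alpha>) ((wave_op c ^^ q) (grid_poly m dx dy 0 0 u)) 0 0)"

definition corner_dx_dy1 :: "nat \<Rightarrow> real \<Rightarrow> real \<Rightarrow> real \<Rightarrow> nat \<Rightarrow> nat \<Rightarrow> functional" where
  "corner_dx_dy1 m c dx dy \<alpha> q = (\<lambda>u.
     (partial_x ^^ \<alpha>) (partial_y ((wave_op c ^^ q) (grid_poly m dx dy 0 0 u))) 0 0)"

definition corner_dy_dx1 :: "nat \<Rightarrow> real \<Rightarrow> real \<Rightarrow> real \<Rightarrow> nat \<Rightarrow> nat \<Rightarrow> functional" where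
  "corner_dy_dx1 m c dx dy \<alpha> q = (\<lambda>u.
     (partial_y ^^ \<alpha>) (partial_x ((wave_op c ^^ q) (grid_poly m dx dy 0 0 u))) 0 0)"

text \<open>The index sets \<open>{0, ..., 2 * m + 1}\<close> without \<open>0, 2, ..., 2 * (q - 1)\<close>, respectively
  without \<open>1, 3, ..., 2 * q - 1\<close>, in increasing order.\<close>

definition M_list :: "nat \<Rightarrow> nat \<Rightarrow> nat list" where
  "M_list m q = filter (\<lambda>\<alpha>. \<alpha> \<notin> {2 * k |k. k < q}) [0..<2*m+2]"

definition N_list :: "nat \<Rightarrow> nat \<Rightarrow> nat list" where
  "N_list m q = filter (\<lambda>\<alpha>. \<alpha> \<notin> {2 * k + 1 |k. k < q}) [0..<2*m+2]"

datatype boundary_kind = D_side | N_side | DD_corner | NN_corner | DN_corner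

text \<open>
  The boundary point is \<open>(0, yj)\<close> for the sides and \<open>(0, 0)\<close> for the corners, which do not use
  \<open>yj\<close>. At a D-N corner the Neumann condition is on \<open>y = 0\<close> and the Dirichlet condition
  on \<open>x = 0\<close>.
\<close>

fun cbc_functionals ::
  "boundary_kind \<Rightarrow> nat \<Rightarrow> real \<Rightarrow> real \<Rightarrow> real \<Rightarrow> real \<Rightarrow> functional list" where
  "cbc_functionals D_side m c dx dy yj =
     matching_list m 1 @ matching_list m (-1) @
     [dirichlet_side m c dx dy yj \<alpha> q. q \<leftarrow> [0..<m+1], \<alpha> \<leftarrow> [0..<2*m+2]]"
| "cbc_functionals N_side m c dx dy yj =
     matching_list m 1 @ matching_list m (-1) @
     [neumann_side m c dx dy yj \<alpha> q. q \<leftarrow> [0..<m+1], \<alpha> \<leftarrow> [0..<2*m+2]]"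
| "cbc_functionals DD_corner m c dx dy yj =
     matching_list m 1 @
     concat [if \<alpha> = 2 * q
             then [average (corner_dx m c dx dy \<alpha> q) (corner_dy m c dx dy \<alpha> q)]
             else [corner_dx m c dx dy \<alpha> q, corner_dy m c dx dy \<alpha> q].
             q \<leftarrow> [0..<m+1], \<alpha> \<leftarrow> M_list m q]"
| "cbc_functionals NN_corner m c dx dy yj =
     matching_list m 1 @
     concat [if \<alpha> = 2 * q + 1
             then [average (corner_dx_dy1 m c dx dy \<alpha> q) (corner_dy_dx1 m c dx dy \<alpha> q)]
             else [corner_dx_dy1 m c dx dy \<alpha> q, corner_dy_dx1 m c dx dy \<alpha> q].
             q \<leftarrow> [0..<m+1], \<alpha> \<leftarrow> N_list m q]"
| "cbc_functionals DN_corner m c dx dy yj =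
     matching_list m 1 @
     concat [[corner_dx_dy1 m c dx dy \<alpha> q. \<alpha> \<leftarrow> M_list m q, \<alpha> \<noteq> 2 * q] @
             [corner_dy m c dx dy \<beta> q. \<beta> \<leftarrow> N_list m q, \<beta> \<noteq> 2 * q + 1] @
             [average (corner_dx_dy1 m c dx dy (2 * q) q) (corner_dy m c dx dy (2 * q + 1) q)].
             q \<leftarrow> [0..<m+1]]"

text \<open>
  All the functionals are linear, so the coefficient of the unknown with indices \<open>(l1, l2)\<close> is the
  value at the corresponding unit array. Column \<open>j\<close> belongs to the unknown with indices
  \<open>(j div (2 * m + 2), j mod (2 * m + 2))\<close>.
\<close>

definition unit_coeffs :: "nat \<Rightarrow> nat \<Rightarrow> coeffs" where
  "unit_coeffs l1 l2 = (\<lambda>k1 k2. if k1 = l1 \<and> k2 = l2 then 1 else 0)"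

definition cbc_matrix ::
  "boundary_kind \<Rightarrow> nat \<Rightarrow> real \<Rightarrow> real \<Rightarrow> real \<Rightarrow> real \<Rightarrow> real mat" where
  "cbc_matrix B m c dx dy yj =
     (let Fs = cbc_functionals B m c dx dy yj in
      Matrix.mat (length Fs) (4 * (m + 1)\<^sup>2)
        (\<lambda>(i, j). (Fs ! i) (unit_coeffs (j div (2 * m + 2)) (j mod (2 * m + 2)))))"

definition row_scale :: "real mat \<Rightarrow> real mat" where
  "row_scale A = Matrix.mat (dim_row A) (dim_col A)
     (\<lambda>(i, j). A $$ (i, j) / Max ((\<lambda>k. \<bar>A $$ (i, k)\<bar>) ` {..<dim_col A}))"

definition mat_norm_inf :: "real mat \<Rightarrow> real" where
  "mat_norm_inf A = Max ((\<lambda>i. \<Sum>j<dim_col A. \<bar>A $$ (i, j)\<bar>) ` {..<dim_row A})"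

text \<open>For a singular matrix the value is meaningless.\<close>

definition cond_inf :: "real mat \<Rightarrow> real" where
  "cond_inf A = mat_norm_inf A * mat_norm_inf (the (mat_inverse A))"

end

theory Submission
  imports Defs "Jordan_Normal_Form.Determinant"
begin

text \<open>
  Nonsingularity. The compatibility conditions are reflection principles in disguise. On a side,
  they state that \<open>L\<^sup>q\<close> of the polynomial (Dirichlet), or the normal derivative of it (Neumann),
  vanishes along \<open>x = 0\<close> for \<open>q \<le> m\<close>. Since \<open>L\<^sup>q\<close> contains the normal derivative of order \<open>2 * q\<close>
  with a nonzero coefficient, and otherwise lower even ones, induction on \<open>q\<close> removes all even
  (Dirichlet) or all odd (Neumann) powers of \<open>x\<close> (lemma \<open>normal_elimination\<close>). A polynomial
  annihilated by the conditions is therefore odd or even in \<open>x\<close>. At a corner the same elimination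
  runs along both edges. The only entries that both edges reach have orders \<open>(px + 2 * q, py + 2 * k)\<close>,
  where \<open>px\<close> and \<open>py\<close> are 0 or 1 according to the kind of condition. The conditions retained in the
  system settle those with \<open>k > q\<close> from one edge, those with \<open>k < q\<close> from the other, and the averages
  settle \<open>k = q\<close> (lemma \<open>corner_elimination\<close>). The polynomial then has a parity in each variable.

  Parity extends the vanishing matching data by reflection to all four points \<open>(\<plusminus>1/2, \<plusminus>1/2)\<close> in
  scaled coordinates. As the degree in each variable is at most \<open>2 * m + 1\<close> and \<open>m + 1\<close> derivatives
  vanish at both nodes of each variable, uniqueness of Hermite interpolation, applied in one
  variable after the other, gives the zero polynomial (lemmas \<open>side_matching_injective\<close> and
  \<open>corner_matching_injective\<close>). A count of the rows shows that the system is square, so a trivial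
  kernel is enough.

  Dependence on the ratio. A compatibility functional is \<open>\<partial>\<^sub>x\<^sup>p \<partial>\<^sub>y\<^sup>r L\<^sup>q\<close> at the boundary point, or
  an average of two of equal \<open>q\<close> and equal total order, whereas the matching functionals contain
  neither \<open>c\<close> nor the mesh widths. By homogeneity each row for \<open>(c, dx, dy)\<close> is a positive multiple
  of the row for \<open>(1, dx / dy, 1)\<close> (lemma \<open>cbc_derivative_scaling\<close>), and dividing a row by its
  largest entry removes the multiple.
\<close>

section \<open>Hermite interpolation at two symmetric nodes\<close>

text \<open>
  The coefficient of \<open>(X - s/2)\<^sup>\<alpha>\<close> in \<open>\<Sum>l\<le>n. w l * X\<^sup>l\<close>, that is, the scaled derivative at
  the node \<open>s/2\<close> that a matching condition prescribes in one variable.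
\<close>

definition taylor_coeff_half :: "nat \<Rightarrow> real \<Rightarrow> nat \<Rightarrow> (nat \<Rightarrow> real) \<Rightarrow> real" where
  "taylor_coeff_half n s \<alpha> w =
     (\<Sum>l=\<alpha>..n. real (l choose \<alpha>) * (s * (1/2)) ^ (l - \<alpha>) * w l)"

lemma coeff_pcompose_shift:
  fixes w :: "nat \<Rightarrow> real"
  shows "coeff (pcompose (\<Sum>l\<le>n. monom (w l) l) [:a, 1:]) \<alpha> =
         (\<Sum>l=\<alpha>..n. real (l choose \<alpha>) * a ^ (l - \<alpha>) * w l)"
proof -
  have mono: "pcompose (monom c l) [:a, 1:] = smult c ([:a, 1:] ^ l)" for c :: real and l
    by (induction l) (simp_all add: monom_0 monom_Suc pcompose_pCons mult.commute)
  have "coeff (pcompose (\<Sum>l\<le>n. monom (w l) l) [:a, 1:]) \<alpha> =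
        (\<Sum>l\<le>n. w l * coeff ([:a, 1:] ^ l) \<alpha>)"
    by (simp add: pcompose_sum coeff_sum mono)
  also have "\<dots> = (\<Sum>l=\<alpha>..n. w l * coeff ([:a, 1:] ^ l) \<alpha>)"
  proof (rule sum.mono_neutral_right)
    show "\<forall>l\<in>{..n} - {\<alpha>..n}. w l * coeff ([:a, 1:] ^ l) \<alpha> = 0"
      by (auto intro!: coeff_eq_0 simp: degree_linear_power)
  qed auto
  also have "\<dots> = (\<Sum>l=\<alpha>..n. real (l choose \<alpha>) * a ^ (l - \<alpha>) * w l)"
    by (intro sum.cong) (auto simp: coeff_linear_poly_power)
  finally show ?thesis .
qed

text \<open>
  Substituting \<open>X + a\<close> for \<open>X\<close> moves the node \<open>a\<close> to the origin, where divisibility by a power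
  of \<open>X\<close> can be read off the coefficients.
\<close>

lemma linear_power_dvd_if_shift_coeffs_vanish:
  fixes p :: "real poly"
  assumes "\<And>\<alpha>. \<alpha> < k \<Longrightarrow> coeff (pcompose p [:a, 1:]) \<alpha> = 0"
  shows "[:-a, 1:] ^ k dvd p"
proof -
  have "monom 1 k dvd pcompose p [:a, 1:]"
    using assms by (simp add: monom_1_dvd_iff')
  then obtain r where r: "pcompose p [:a, 1:] = monom 1 k * r"
    by (elim dvdE)
  have "p = pcompose (pcompose p [:a, 1:]) [:-a, 1:]"
    by (simp add: pcompose_assoc[symmetric] pcompose_pCons)
  also have "\<dots> = pcompose (monom 1 k) [:-a, 1:] * pcompose r [:-a, 1:]"
    by (simp add: r pcompose_mult)
  also have "pcompose (monom 1 k) [:-a, 1:] = [:-a, 1:] ^ k"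
    by (induction k) (simp_all add: monom_0 monom_Suc pcompose_pCons mult.commute)
  finally show ?thesis
    by simp
qed

text \<open>
  A polynomial of degree at most \<open>2 * m + 1\<close> with a zero of multiplicity \<open>m + 1\<close> at each of the two
  nodes \<open>1/2\<close> and \<open>-1/2\<close> has more zeros than its degree allows.
\<close>

lemma hermite_two_points:
  assumes vanish: "\<And>s \<alpha>. s \<in> {1, -1} \<Longrightarrow> \<alpha> \<le> m \<Longrightarrow> taylor_coeff_half (2*m+1) s \<alpha> w = 0"
    and "l \<le> 2*m+1"
  shows "w l = 0"
proof -
  define p where "p = (\<Sum>l\<le>2*m+1. monom (w l) l)"
  have "[:-(s * (1/2)), 1:] ^ (m+1) dvd p" if "s \<in> {1, -1}" for s
    using vanish[OF that]
    by (intro linear_power_dvd_if_shift_coeffs_vanish)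
      (simp add: p_def coeff_pcompose_shift taylor_coeff_half_def del: sum.atMost_Suc)
  from this[of 1] this[of "-1"]
  have dvd: "[:-(1/2), 1:] ^ (m+1) dvd p" "[:-(-1/2), 1:] ^ (m+1) dvd p"
    by auto
  have "p = 0"
  proof (rule ccontr)
    assume "p \<noteq> 0"
    obtain r where r: "p = [:-(1/2), 1:] ^ (m+1) * r"
      using dvd(1) by (elim dvdE)
    have "r \<noteq> 0"
      using \<open>p \<noteq> 0\<close> r by auto
    have "m + 1 \<le> order (-1/2 :: real) p"
      using dvd(2) \<open>p \<noteq> 0\<close> unfolding order_divides by simp
    also have "order (-1/2 :: real) p = order (-1/2 :: real) ([:-(1/2), 1:] ^ (m+1)) + order (-1/2 :: real) r"
      using \<open>p \<noteq> 0\<close> unfolding r by (rule order_mult)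
    also have "order (-1/2 :: real) ([:-(1/2), 1:] ^ (m+1)) = 0"
      by (rule order_0I) (simp add: poly_power)
    also have "order (-1/2 :: real) r \<le> degree r"
      using \<open>r \<noteq> 0\<close> by (rule order_degree)
    finally have "m + 1 \<le> degree r"
      by simp
    moreover have "degree p = (m + 1) + degree r"
      unfolding r using \<open>r \<noteq> 0\<close>
      by (simp add: degree_mult_eq degree_linear_power del: power_Suc flip: Suc_eq_plus1)
    moreover have "degree p \<le> 2*m+1"
      unfolding p_def by (rule degree_sum_le) (auto intro: order.trans[OF degree_monom_le])
    ultimately show False
      by simp
  qed
  then have "coeff p l = 0"
    by simp
  then show ?thesis
    using \<open>l \<le> 2*m+1\<close> by (simp add: p_def coeff_sum del: sum.atMost_Suc)
qed

text \<open>
  For an even or odd polynomial (\<open>e\<close> carries the parity) the data at \<open>-1/2\<close> are, up to sign, the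
  data at \<open>1/2\<close>, so one node is as good as two.
\<close>

lemma hermite_one_point_parity:
  assumes parity: "\<And>l. w l \<noteq> 0 \<Longrightarrow> even (l + e)"
    and vanish: "\<And>\<alpha>. \<alpha> \<le> m \<Longrightarrow> taylor_coeff_half (2*m+1) 1 \<alpha> w = 0"
    and l: "l \<le> 2*m+1"
  shows "w l = 0"
proof -
  have "taylor_coeff_half (2*m+1) (-1) \<alpha> w = (-1) ^ (\<alpha> + e) * taylor_coeff_half (2*m+1) 1 \<alpha> w"
    for \<alpha>
    unfolding taylor_coeff_half_def sum_distrib_left
  proof (rule sum.cong[OF refl])
    fix l assume "l \<in> {\<alpha>..2*m+1}"
    then obtain d where d: "l = \<alpha> + d"
      using le_Suc_ex by auto
    show "real (l choose \<alpha>) * (- 1 * (1/2)) ^ (l - \<alpha>) * w l =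
          (-1) ^ (\<alpha> + e) * (real (l choose \<alpha>) * (1 * (1/2)) ^ (l - \<alpha>) * w l)"
    proof (cases "w l = 0")
      case False
      from parity[OF this] have "even (d + (\<alpha> + e))"
        by (simp add: d add_ac)
      then have "(-1::real) ^ d = (-1) ^ (\<alpha> + e)"
        by (auto simp: minus_one_power_iff)
      moreover have "(- 1 * (1/2)) ^ d = (-1) ^ d * (1/2::real) ^ d"
        by (rule power_mult_distrib)
      ultimately show ?thesis
        by (simp add: d)
    qed simp
  qed
  with vanish have "taylor_coeff_half (2*m+1) s \<alpha> w = 0" if "s \<in> {1, -1}" "\<alpha> \<le> m" for s \<alpha>
    using that by auto
  from hermite_two_points[OF this l] show ?thesis
    by blast
qed

text \<open>
  The matching conditions are a tensor product of one-dimensional Taylor coefficients. This allows the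
  two variables to be treated one after the other.
\<close>

lemma matching_iterated:
  "matching m s \<alpha> \<beta> u =
     taylor_coeff_half (2*m+1) 1 \<alpha> (\<lambda>l1. taylor_coeff_half (2*m+1) s \<beta> (u l1))"
  unfolding matching_def taylor_coeff_half_def sum_distrib_left
  by (intro sum.cong refl) (simp add: mult_ac)

text \<open>
  If \<open>u\<close> has a parity in \<open>x\<close>, interpolation in \<open>x\<close> removes the sum over \<open>l1\<close> from the
  matching conditions and leaves one-dimensional conditions in \<open>y\<close> on every row of the array.
\<close>

lemma matching_reduce_x:
  assumes "\<And>l1 l2. u l1 l2 \<noteq> 0 \<Longrightarrow> l1 \<le> 2*m+1 \<Longrightarrow> l2 \<le> 2*m+1 \<Longrightarrow> even (l1 + e)"
    and "\<And>\<alpha>. \<alpha> \<le> m \<Longrightarrow> matching m s \<alpha> \<beta> u = 0"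
    and "l1 \<le> 2*m+1"
  shows "taylor_coeff_half (2*m+1) s \<beta> (u l1) = 0"
proof -
  \<comment> \<open>The parity of \<open>u\<close> is known only for indices in range, hence the truncation.\<close>
  define w where "w l = (if l \<le> 2*m+1 then taylor_coeff_half (2*m+1) s \<beta> (u l) else 0)" for l
  have "w l1 = 0"
  proof (rule hermite_one_point_parity[where e = e])
    fix l assume "w l \<noteq> 0"
    then have l: "l \<le> 2*m+1" "taylor_coeff_half (2*m+1) s \<beta> (u l) \<noteq> 0"
      by (auto simp: w_def split: if_splits)
    then obtain l2 where "l2 \<le> 2*m+1" "u l l2 \<noteq> 0"
      unfolding taylor_coeff_half_def
      by (elim sum.not_neutral_contains_not_neutral) auto
    with assms(1) l show "even (l + e)"
      by blast
  next
    fix \<alpha> assume "\<alpha> \<le> m"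
    have "taylor_coeff_half (2*m+1) 1 \<alpha> w = matching m s \<alpha> \<beta> u"
      unfolding matching_iterated by (subst (1 2) taylor_coeff_half_def) (simp add: w_def)
    with assms(2)[OF \<open>\<alpha> \<le> m\<close>] show "taylor_coeff_half (2*m+1) 1 \<alpha> w = 0"
      by simp
  qed (fact assms(3))
  with assms(3) show ?thesis
    by (simp add: w_def)
qed

text \<open>
  At a side the data at both signs supply the two nodes in \<open>y\<close>; only in \<open>x\<close> is a parity needed.
\<close>

lemma side_matching_injective:
  assumes "\<And>l1 l2. u l1 l2 \<noteq> 0 \<Longrightarrow> l1 \<le> 2*m+1 \<Longrightarrow> l2 \<le> 2*m+1 \<Longrightarrow> even (l1 + e)"
    and "\<And>s \<alpha> \<beta>. s \<in> {1, -1} \<Longrightarrow> \<alpha> \<le> m \<Longrightarrow> \<beta> \<le> m \<Longrightarrow> matching m s \<alpha> \<beta> u = 0"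
    and "l1 \<le> 2*m+1" "l2 \<le> 2*m+1"
  shows "u l1 l2 = 0"
  using matching_reduce_x[of u m e] assms by (intro hermite_two_points[of m "u l1"]) blast+

text \<open>
  At a corner the single node in each variable is doubled by the parity in that variable.
\<close>

lemma corner_matching_injective:
  assumes "\<And>l1 l2. u l1 l2 \<noteq> 0 \<Longrightarrow> l1 \<le> 2*m+1 \<Longrightarrow> l2 \<le> 2*m+1 \<Longrightarrow> even (l1 + e) \<and> even (l2 + e')"
    and "\<And>\<alpha> \<beta>. \<alpha> \<le> m \<Longrightarrow> \<beta> \<le> m \<Longrightarrow> matching m 1 \<alpha> \<beta> u = 0"
    and "l1 \<le> 2*m+1" "l2 \<le> 2*m+1"
  shows "u l1 l2 = 0"
proof -
  define w where "w l = (if l \<le> 2*m+1 then u l1 l else 0)" for l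
  have "w l2 = 0"
  proof (rule hermite_one_point_parity[where e = e'])
    fix \<alpha> assume "\<alpha> \<le> m"
    have "taylor_coeff_half (2*m+1) 1 \<alpha> w = taylor_coeff_half (2*m+1) 1 \<alpha> (u l1)"
      unfolding taylor_coeff_half_def by (simp add: w_def)
    also have "\<dots> = 0"
      using assms \<open>\<alpha> \<le> m\<close> by (intro matching_reduce_x[where e = e]) blast+
    finally show "taylor_coeff_half (2*m+1) 1 \<alpha> w = 0" .
  qed (use assms in \<open>auto simp: w_def split: if_splits\<close>)
  with assms(4) show ?thesis
    by (simp add: w_def)
qed

section \<open>Derivatives of the grid polynomial\<close>

text \<open>
  The function \<open>f\<close> is a polynomial of degree at most \<open>n\<close> in each variable and \<open>a i j\<close> is its
  derivative \<open>\<partial>\<^sub>x\<^sup>i \<partial>\<^sub>y\<^sup>j\<close> at \<open>(x0, y0)\<close>. In terms of the array of derivatives, a partial derivative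
  is a shift of indices. Requiring the entries beyond \<open>n\<close> to vanish makes this exact, with no
  truncation at the top degree.
\<close>

definition has_jet ::
  "nat \<Rightarrow> real \<Rightarrow> real \<Rightarrow> (real \<Rightarrow> real \<Rightarrow> real) \<Rightarrow> (nat \<Rightarrow> nat \<Rightarrow> real) \<Rightarrow> bool" where
  "has_jet n x0 y0 f a \<longleftrightarrow>
     (\<forall>i j. n < i \<or> n < j \<longrightarrow> a i j = 0) \<and>
     f = (\<lambda>x y. \<Sum>i\<le>n. \<Sum>j\<le>n. a i j * (((x - x0) ^ i / fact i) * ((y - y0) ^ j / fact j)))"

lemma deriv_taylor_sum:
  fixes b :: "nat \<Rightarrow> real"
  assumes "b (Suc n) = 0"
  shows "deriv (\<lambda>s. \<Sum>i\<le>n. b i * ((s - x0) ^ i / fact i)) x =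
         (\<Sum>i\<le>n. b (Suc i) * ((x - x0) ^ i / fact i))"
proof -
  define d :: "nat \<Rightarrow> real" where "d i = (case i of 0 \<Rightarrow> 0 | Suc k \<Rightarrow> (x - x0) ^ k / fact k)" for i
  have "((\<lambda>s. (s - x0) ^ i / fact i) has_field_derivative d i) (at x)" for i
  proof (cases i)
    case (Suc k)
    have "((\<lambda>s. (s - x0) ^ Suc k) has_field_derivative real (Suc k) * (x - x0) ^ k) (at x)"
      by (rule derivative_eq_intros refl)+ simp
    then have "((\<lambda>s. (s - x0) ^ Suc k / fact (Suc k)) has_field_derivative
            real (Suc k) * (x - x0) ^ k / fact (Suc k)) (at x)"
      by (rule DERIV_cdivide)
    also have "real (Suc k) * (x - x0) ^ k / fact (Suc k) = d i"
      by (simp add: d_def Suc fact_Suc del: of_nat_Suc)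
    finally show ?thesis
      by (simp add: Suc)
  qed (simp add: d_def)
  then have "deriv (\<lambda>s. \<Sum>i\<le>n. b i * ((s - x0) ^ i / fact i)) x = (\<Sum>i\<le>n. b i * d i)"
    by (intro DERIV_imp_deriv DERIV_sum DERIV_cmult)
  also have "\<dots> = (\<Sum>i\<le>n. b (Suc i) * ((x - x0) ^ i / fact i))"
  proof (cases n)
    case 0
    with assms show ?thesis by (simp add: d_def)
  next
    case (Suc k)
    with assms show ?thesis
      by (simp only: Suc, subst sum.atMost_Suc_shift) (simp add: d_def)
  qed
  finally show ?thesis .
qed

lemma has_jet_swap: "has_jet n x0 y0 f a \<Longrightarrow> has_jet n y0 x0 (\<lambda>x y. f y x) (\<lambda>i j. a j i)"
  unfolding has_jet_def
  by (subst sum.swap) (auto simp: mult_ac)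

lemma has_jet_partial_x:
  assumes "has_jet n x0 y0 f a"
  shows "has_jet n x0 y0 (partial_x f) (\<lambda>i j. a (Suc i) j)"
proof -
  have f: "f = (\<lambda>x y. \<Sum>i\<le>n. (\<Sum>j\<le>n. a i j * ((y - y0) ^ j / fact j)) * ((x - x0) ^ i / fact i))"
    and zero: "\<And>i j. n < i \<or> n < j \<Longrightarrow> a i j = 0"
    using assms unfolding has_jet_def by (auto simp: sum_distrib_left sum_distrib_right mult_ac)
  show ?thesis
    unfolding has_jet_def partial_x_def f
    by (subst deriv_taylor_sum) (auto simp: zero sum_distrib_left sum_distrib_right mult_ac)
qed

lemma has_jet_partial_y:
  assumes "has_jet n x0 y0 f a"
  shows "has_jet n x0 y0 (partial_y f) (\<lambda>i j. a i (Suc j))"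
  using has_jet_swap[OF has_jet_partial_x[OF has_jet_swap[OF assms]]]
  by (simp add: partial_x_def partial_y_def)

lemma has_jet_partial_x_funpow:
  "has_jet n x0 y0 f a \<Longrightarrow> has_jet n x0 y0 ((partial_x ^^ k) f) (\<lambda>i j. a (i + k) j)"
  by (induction k) (auto dest: has_jet_partial_x)

lemma has_jet_partial_y_funpow:
  "has_jet n x0 y0 f a \<Longrightarrow> has_jet n x0 y0 ((partial_y ^^ k) f) (\<lambda>i j. a i (j + k))"
  by (induction k) (auto dest: has_jet_partial_y)

lemma has_jet_at_base:
  assumes "has_jet n x0 y0 f a"
  shows "f x0 y0 = a 0 0"
proof -
  have "f x0 y0 = (\<Sum>i\<le>n. if i = 0 then (\<Sum>j\<le>n. if j = 0 then a 0 j else 0) else 0)"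
    using assms unfolding has_jet_def
    by (auto intro!: sum.cong simp: power_0_left simp del: sum.delta sum.delta')
  then show ?thesis
    by simp
qed

text \<open>
  The value of \<open>\<partial>\<^sub>x\<^sup>p \<partial>\<^sub>y\<^sup>r (\<partial>\<^sub>x\<^sup>2 + \<partial>\<^sub>y\<^sup>2)\<^sup>q\<close> at the base point, expanded by the binomial theorem
  over the array \<open>a\<close> of derivatives.
\<close>

definition laplace_jet :: "nat \<Rightarrow> nat \<Rightarrow> nat \<Rightarrow> (nat \<Rightarrow> nat \<Rightarrow> real) \<Rightarrow> real" where
  "laplace_jet q p r a = (\<Sum>k\<le>q. real (q choose k) * a (p + 2 * (q - k)) (r + 2 * k))"

lemma laplace_jet_0 [simp]: "laplace_jet 0 p r a = a p r"
  by (simp add: laplace_jet_def)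

lemma laplace_jet_Suc:
  "laplace_jet (Suc q) p r a = laplace_jet q (p + 2) r a + laplace_jet q p (r + 2) a"
proof -
  define g where "g k = a (p + 2 * (Suc q - k)) (r + 2 * k)" for k
  have "laplace_jet (Suc q) p r a = g 0 + (\<Sum>k\<le>q. real (Suc q choose Suc k) * g (Suc k))"
    unfolding laplace_jet_def g_def by (subst sum.atMost_Suc_shift) simp
  also have "\<dots> = (g 0 + (\<Sum>k\<le>q. real (q choose Suc k) * g (Suc k)))
                  + (\<Sum>k\<le>q. real (q choose k) * g (Suc k))"
    by (simp add: algebra_simps sum.distrib)
  also have "g 0 + (\<Sum>k\<le>q. real (q choose Suc k) * g (Suc k)) =
             (\<Sum>k\<le>Suc q. real (q choose k) * g k)"
    by (subst sum.atMost_Suc_shift) simp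
  also have "\<dots> = (\<Sum>k\<le>q. real (q choose k) * g k)"
    by simp
  also have "\<dots> = laplace_jet q (p + 2) r a"
    unfolding laplace_jet_def g_def
    by (intro sum.cong refl) (auto simp: Suc_diff_le)
  also have "(\<Sum>k\<le>q. real (q choose k) * g (Suc k)) = laplace_jet q p (r + 2) a"
    unfolding laplace_jet_def g_def by (intro sum.cong refl) auto
  finally show ?thesis .
qed

lemma laplace_jet_transpose: "laplace_jet q p r (\<lambda>i j. a j i) = laplace_jet q r p a"
proof (induction q arbitrary: p r)
  case (Suc q)
  then show ?case by (simp add: laplace_jet_Suc)
qed simp

lemma has_jet_wave_op:
  assumes "has_jet n x0 y0 f a"
  shows "has_jet n x0 y0 (wave_op c f) (\<lambda>i j. c\<^sup>2 * (a (i + 2) j + a i (j + 2)))"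
  using has_jet_partial_x_funpow[OF assms, of 2] has_jet_partial_y_funpow[OF assms, of 2]
  unfolding has_jet_def wave_op_def
  by (auto simp: sum_distrib_left sum.distrib algebra_simps)

lemma has_jet_wave_op_funpow:
  assumes "has_jet n x0 y0 f a"
  shows "has_jet n x0 y0 ((wave_op c ^^ q) f) (\<lambda>i j. c ^ (2 * q) * laplace_jet q i j a)"
proof (induction q)
  case (Suc q)
  from has_jet_wave_op[OF this, of c] show ?case
    by (simp add: laplace_jet_Suc algebra_simps power2_eq_square)
qed (use assms in simp)

text \<open>
  The unscaled derivatives of the grid polynomial at its centre. In these unknowns the Laplacian does
  not see the mesh widths, so the elimination below is the same for every aspect ratio.
\<close>

definition grid_jet :: "nat \<Rightarrow> real \<Rightarrow> real \<Rightarrow> coeffs \<Rightarrow> nat \<Rightarrow> nat \<Rightarrow> real" where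
  "grid_jet m dx dy u i j =
     (if i \<le> 2*m+1 \<and> j \<le> 2*m+1 then fact i * fact j * u i j / (dx ^ i * dy ^ j) else 0)"

lemma has_jet_grid_poly: "has_jet (2*m+1) xi yj (grid_poly m dx dy xi yj u) (grid_jet m dx dy u)"
  unfolding has_jet_def grid_poly_def
  by (auto intro!: ext sum.cong simp: atLeast0AtMost grid_jet_def power_divide
      simp del: sum.atMost_Suc)

lemma grid_jet_outside: "2*m+1 < i \<or> 2*m+1 < j \<Longrightarrow> grid_jet m dx dy u i j = 0"
  by (auto simp: grid_jet_def)

text \<open>
  The common form \<open>\<partial>\<^sub>x\<^sup>p \<partial>\<^sub>y\<^sup>r L\<^sup>q\<close> of all compatibility conditions.
\<close>

definition cbc_derivative ::
  "nat \<Rightarrow> real \<Rightarrow> real \<Rightarrow> real \<Rightarrow> nat \<Rightarrow> nat \<Rightarrow> nat \<Rightarrow> functional" where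
  "cbc_derivative m c dx dy q p r = (\<lambda>u. c ^ (2 * q) * laplace_jet q p r (grid_jet m dx dy u))"

lemma cbc_functionals_as_derivatives:
  "dirichlet_side m c dx dy yj \<alpha> q = cbc_derivative m c dx dy q 0 \<alpha>"
  "neumann_side m c dx dy yj \<alpha> q = cbc_derivative m c dx dy q 1 \<alpha>"
  "corner_dx m c dx dy \<alpha> q = cbc_derivative m c dx dy q \<alpha> 0"
  "corner_dy m c dx dy \<alpha> q = cbc_derivative m c dx dy q 0 \<alpha>"
  "corner_dx_dy1 m c dx dy \<alpha> q = cbc_derivative m c dx dy q \<alpha> 1"
  "corner_dy_dx1 m c dx dy \<alpha> q = cbc_derivative m c dx dy q 1 \<alpha>"
proof -
  have jet: "has_jet (2*m+1) 0 y0 ((wave_op c ^^ q) (grid_poly m dx dy 0 y0 u))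
               (\<lambda>i j. c ^ (2 * q) * laplace_jet q i j (grid_jet m dx dy u))" for u y0
    by (intro has_jet_wave_op_funpow has_jet_grid_poly)
  note ids = dirichlet_side_def neumann_side_def corner_dx_def corner_dy_def
    corner_dx_dy1_def corner_dy_dx1_def cbc_derivative_def
  show "dirichlet_side m c dx dy yj \<alpha> q = cbc_derivative m c dx dy q 0 \<alpha>"
    "corner_dy m c dx dy \<alpha> q = cbc_derivative m c dx dy q 0 \<alpha>"
    using has_jet_at_base[OF has_jet_partial_y_funpow[OF jet]] by (simp_all add: ids)
  show "corner_dx m c dx dy \<alpha> q = cbc_derivative m c dx dy q \<alpha> 0"
    using has_jet_at_base[OF has_jet_partial_x_funpow[OF jet]] by (simp add: ids)
  show "neumann_side m c dx dy yj \<alpha> q = cbc_derivative m c dx dy q 1 \<alpha>"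
    "corner_dy_dx1 m c dx dy \<alpha> q = cbc_derivative m c dx dy q 1 \<alpha>"
    using has_jet_at_base[OF has_jet_partial_y_funpow[OF has_jet_partial_x[OF jet]]]
    by (simp_all add: ids)
  show "corner_dx_dy1 m c dx dy \<alpha> q = cbc_derivative m c dx dy q \<alpha> 1"
    using has_jet_at_base[OF has_jet_partial_x_funpow[OF has_jet_partial_y[OF jet]]]
    by (simp add: ids)
qed

section \<open>The boundary conditions force a parity\<close>

text \<open>
  Among the derivatives that occur in \<open>\<partial>\<^sub>x\<^sup>p \<partial>\<^sub>y\<^sup>r \<Delta>\<^sup>q\<close>, the one with the most derivatives in \<open>x\<close> has
  coefficient 1. Once all the others are known to vanish, the condition isolates it.
\<close>

lemma laplace_jet_normal_leading:
  assumes "\<And>k. k < q \<Longrightarrow> a (p + 2 * k) (r + 2 * (q - k)) = 0"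
  shows "laplace_jet q p r a = a (p + 2 * q) r"
proof -
  have "laplace_jet q p r a = (\<Sum>k\<le>q. real (q choose k) * a (p + 2 * k) (r + 2 * (q - k)))"
    using laplace_jet_transpose[of q r p a] by (simp add: laplace_jet_def)
  also have "\<dots> = (\<Sum>k\<le>q. if k = q then a (p + 2 * q) r else 0)"
    using assms by (intro sum.cong) auto
  finally show ?thesis
    by simp
qed

text \<open>
  Here \<open>x\<close> is the normal and \<open>y\<close> the tangential direction. A condition with \<open>\<Delta>\<^sup>q\<close> and tangential
  order \<open>r\<close> involves, besides the derivative of normal order \<open>p + 2 * q\<close>, only derivatives of normal
  order \<open>p + 2 * k\<close> with \<open>k < q\<close> and tangential order \<open>r + 2 * (q - k)\<close>. The conditions are thus
  triangular and induction on \<open>q\<close> solves them. The predicate \<open>P\<close> selects the available conditions;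
  it has to contain the smaller conditions that the induction calls upon.
\<close>

lemma normal_elimination:
  assumes zero: "\<And>i j. 2*m+1 < i \<or> 2*m+1 < j \<Longrightarrow> a i j = 0"
    and closed: "\<And>r q k. P r q \<Longrightarrow> k < q \<Longrightarrow> P (r + 2 * (q - k)) k"
    and eqn: "\<And>r q. P r q \<Longrightarrow> q \<le> m \<Longrightarrow> r \<le> 2*m+1 \<Longrightarrow> laplace_jet q p r a = 0"
    and "P r q"
  shows "a (p + 2 * q) r = 0"
  using \<open>P r q\<close>
proof (induction q arbitrary: r rule: less_induct)
  case (less q)
  show ?case
  proof (cases "q \<le> m \<and> r \<le> 2*m+1")
    case True
    have "a (p + 2 * q) r = laplace_jet q p r a"
      using less closed by (intro laplace_jet_normal_leading[symmetric]) blast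
    with True eqn less.prems show ?thesis
      by simp
  next
    case False
    then show ?thesis
      by (intro zero) auto
  qed
qed

text \<open>
  In the applications \<open>px\<close> and \<open>py\<close> are the orders (0 for Dirichlet, 1 for Neumann) of the boundary
  derivative on \<open>x = 0\<close> and on \<open>y = 0\<close>. The conditions \<open>Y\<close> on \<open>x = 0\<close> determine the derivatives of
  order \<open>px + 2 * q\<close> in \<open>x\<close>, the conditions \<open>X\<close> on \<open>y = 0\<close> those of order \<open>py + 2 * k\<close> in \<open>y\<close>. Only
  a derivative of order \<open>(px + 2 * q, py + 2 * k)\<close> is of both kinds. There, \<open>Y\<close> covers the entries
  with \<open>k > q\<close> and \<open>X\<close> those with \<open>k < q\<close>; the conditions that would repeat this work from the
  other edge are the ones left out of the system. On the diagonal \<open>k = q\<close> both families have the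
  same leading derivative, so that, with everything off the diagonal already zero, their average is
  that derivative.
\<close>

lemma corner_elimination:
  assumes zero: "\<And>i j. 2*m+1 < i \<or> 2*m+1 < j \<Longrightarrow> a i j = 0"
    and p: "px \<le> 1" "py \<le> 1"
    and X: "\<And>q \<alpha>. q \<le> m \<Longrightarrow> \<alpha> \<le> 2*m+1 \<Longrightarrow> \<not> (even (\<alpha> + px) \<and> \<alpha> \<le> 2*q + px) \<Longrightarrow>
               laplace_jet q \<alpha> py a = 0"
    and Y: "\<And>q \<beta>. q \<le> m \<Longrightarrow> \<beta> \<le> 2*m+1 \<Longrightarrow> \<not> (even (\<beta> + py) \<and> \<beta> \<le> 2*q + py) \<Longrightarrow>
               laplace_jet q px \<beta> a = 0"
    and avg: "\<And>q. q \<le> m \<Longrightarrow> laplace_jet q (2*q + px) py a + laplace_jet q px (2*q + py) a = 0"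
    and ij: "even (i + px) \<or> even (j + py)"
  shows "a i j = 0"
proof -
  have y: "a (px + 2 * q) r = 0" if "\<not> (even (r + py) \<and> r \<le> 2*q + py)" for q r
    by (rule normal_elimination[where P = "\<lambda>r q. \<not> (even (r + py) \<and> r \<le> 2*q + py)" and m = m])
      (use zero Y that in auto)
  have x: "a r (py + 2 * q) = 0" if "\<not> (even (r + px) \<and> r \<le> 2*q + px)" for q r
    by (rule normal_elimination[where P = "\<lambda>r q. \<not> (even (r + px) \<and> r \<le> 2*q + px)"
          and m = m and a = "\<lambda>i j. a j i"])
      (use zero X that in \<open>auto simp: laplace_jet_transpose[of _ _ _ a]\<close>)
  have diagonal: "a (px + 2 * q) (py + 2 * q) = 0" for q
  proof (cases "q \<le> m")
    case True
    have "laplace_jet q px (2*q + py) a = a (px + 2 * q) (2*q + py)"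
      by (rule laplace_jet_normal_leading) (auto intro: y)
    moreover have "laplace_jet q py (2*q + px) (\<lambda>i j. a j i) = a (2*q + px) (py + 2 * q)"
      by (rule laplace_jet_normal_leading) (auto intro: x)
    ultimately show ?thesis
      using avg[OF True] by (simp add: laplace_jet_transpose[of _ _ _ a] add.commute)
  qed (auto intro: zero)
  have split: "\<exists>q. n = p + 2 * q" if "even (n + p)" "p \<le> 1" for n p :: nat
    using that by presburger
  consider q k where "i = px + 2 * q" "j = py + 2 * k" "k = q"
    | q where "i = px + 2 * q" "\<not> (even (j + py) \<and> j \<le> 2*q + py)"
    | k where "j = py + 2 * k" "\<not> (even (i + px) \<and> i \<le> 2*k + px)"
  proof (cases "even (i + px) \<and> even (j + py)")
    case True
    then obtain q k where qk: "i = px + 2 * q" "j = py + 2 * k"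
      using split p by meson
    consider "k = q" | "q < k" | "k < q"
      by linarith
    then show thesis
      using that qk by cases auto
  next
    case False
    with ij split p that show thesis
      by metis
  qed
  then show ?thesis
    by cases (use x y diagonal in auto)
qed

lemma grid_jet_eq_0_iff:
  assumes "dx > 0" "dy > 0" "i \<le> 2*m+1" "j \<le> 2*m+1"
  shows "grid_jet m dx dy u i j = 0 \<longleftrightarrow> u i j = 0"
  using assms by (simp add: grid_jet_def)

lemma cbc_derivative_eq_0_iff:
  "c > 0 \<Longrightarrow> cbc_derivative m c dx dy q p r u = 0 \<longleftrightarrow> laplace_jet q p r (grid_jet m dx dy u) = 0"
  by (simp add: cbc_derivative_def)

text \<open>
  The conditions at a side say that \<open>L\<^sup>q\<close> of the polynomial (or its normal derivative) vanishes
  identically along \<open>x = 0\<close>, which makes the polynomial odd (Dirichlet, \<open>p = 0\<close>) or even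
  (Neumann, \<open>p = 1\<close>) in \<open>x\<close>. Interpolation then leaves only zero.
\<close>

lemma side_determines_coeffs:
  assumes pos: "c > 0" "dx > 0" "dy > 0" and "p \<le> 1"
    and matching: "\<And>s \<alpha> \<beta>. s \<in> {1, -1} \<Longrightarrow> \<alpha> \<le> m \<Longrightarrow> \<beta> \<le> m \<Longrightarrow> matching m s \<alpha> \<beta> u = 0"
    and cbc: "\<And>q \<alpha>. q \<le> m \<Longrightarrow> \<alpha> \<le> 2*m+1 \<Longrightarrow> cbc_derivative m c dx dy q p \<alpha> u = 0"
    and "l1 \<le> 2*m+1" "l2 \<le> 2*m+1"
  shows "u l1 l2 = 0"
proof (rule side_matching_injective[where e = "p + 1"])
  fix l1 l2 assume nonzero: "u l1 l2 \<noteq> 0" "l1 \<le> 2*m+1" "l2 \<le> 2*m+1"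
  have jet: "grid_jet m dx dy u (p + 2 * q) r = 0" for q r
    by (rule normal_elimination[where P = "\<lambda>r q. True" and m = m])
      (use cbc pos in \<open>auto simp: grid_jet_outside cbc_derivative_eq_0_iff\<close>)
  show "even (l1 + (p + 1))"
  proof (rule ccontr)
    assume "odd (l1 + (p + 1))"
    with \<open>p \<le> 1\<close> have "\<exists>q. l1 = p + 2 * q"
      by presburger
    then obtain q where "l1 = p + 2 * q" ..
    with jet nonzero pos show False
      using grid_jet_eq_0_iff by metis
  qed
qed (fact assms)+

text \<open>
  The three kinds of corners differ only in \<open>px\<close> and \<open>py\<close>. In each variable separately the
  polynomial turns out odd for a Dirichlet and even for a Neumann condition, which is the parity that
  interpolation at the one node needs.
\<close>

lemma corner_determines_coeffs:
  assumes pos: "c > 0" "dx > 0" "dy > 0" and p: "px \<le> 1" "py \<le> 1"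
    and matching: "\<And>\<alpha> \<beta>. \<alpha> \<le> m \<Longrightarrow> \<beta> \<le> m \<Longrightarrow> matching m 1 \<alpha> \<beta> u = 0"
    and X: "\<And>q \<alpha>. q \<le> m \<Longrightarrow> \<alpha> \<le> 2*m+1 \<Longrightarrow> \<not> (even (\<alpha> + px) \<and> \<alpha> \<le> 2*q + px) \<Longrightarrow>
               cbc_derivative m c dx dy q \<alpha> py u = 0"
    and Y: "\<And>q \<beta>. q \<le> m \<Longrightarrow> \<beta> \<le> 2*m+1 \<Longrightarrow> \<not> (even (\<beta> + py) \<and> \<beta> \<le> 2*q + py) \<Longrightarrow>
               cbc_derivative m c dx dy q px \<beta> u = 0"
    and avg: "\<And>q. q \<le> m \<Longrightarrow> average (cbc_derivative m c dx dy q (2*q + px) py)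
                                   (cbc_derivative m c dx dy q px (2*q + py)) u = 0"
    and "l1 \<le> 2*m+1" "l2 \<le> 2*m+1"
  shows "u l1 l2 = 0"
proof (rule corner_matching_injective[where e = "px + 1" and e' = "py + 1"])
  fix l1 l2 assume nonzero: "u l1 l2 \<noteq> 0" "l1 \<le> 2*m+1" "l2 \<le> 2*m+1"
  let ?a = "grid_jet m dx dy u"
  have avg': "laplace_jet q (2*q + px) py ?a + laplace_jet q px (2*q + py) ?a = 0" if "q \<le> m" for q
  proof -
    have "c ^ (2 * q) * (laplace_jet q (2*q + px) py ?a + laplace_jet q px (2*q + py) ?a) = 0"
      using avg[OF that] by (simp add: average_def cbc_derivative_def distrib_left)
    with pos show ?thesis
      by simp
  qed
  note jet_eq = cbc_derivative_eq_0_iff[OF pos(1), THEN iffD1]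
  have "?a l1 l2 = 0" if "even (l1 + px) \<or> even (l2 + py)"
    using grid_jet_outside p jet_eq[OF X] jet_eq[OF Y] avg' that
    by (rule corner_elimination)
  with nonzero pos have "\<not> (even (l1 + px) \<or> even (l2 + py))"
    using grid_jet_eq_0_iff by blast
  then show "even (l1 + (px + 1)) \<and> even (l2 + (py + 1))"
    by auto
qed (fact assms)+

section \<open>A trivial kernel\<close>

lemma set_matching_list:
  "set (matching_list m s) = {matching m s \<alpha> \<beta> |\<alpha> \<beta>. \<alpha> \<le> m \<and> \<beta> \<le> m}"
  by (fastforce simp: matching_list_def image_iff)

lemma set_M_list: "\<alpha> \<in> set (M_list m q) \<longleftrightarrow> \<alpha> \<le> 2*m+1 \<and> \<not> (even \<alpha> \<and> \<alpha> < 2 * q)"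
proof -
  have "\<alpha> \<in> {2 * k |k. k < q} \<longleftrightarrow> even \<alpha> \<and> \<alpha> < 2 * q"
    by (auto elim!: evenE)
  then show ?thesis
    unfolding M_list_def by (simp only: set_filter) auto
qed

lemma set_N_list: "\<alpha> \<in> set (N_list m q) \<longleftrightarrow> \<alpha> \<le> 2*m+1 \<and> \<not> (odd \<alpha> \<and> \<alpha> < 2 * q + 1)"
proof -
  have "\<alpha> \<in> {2 * k + 1 |k. k < q} \<longleftrightarrow> odd \<alpha> \<and> \<alpha> < 2 * q + 1"
    by (auto elim!: oddE)
  then show ?thesis
    unfolding N_list_def by (simp only: set_filter) auto
qed

text \<open>
  The system is given as a list. The following lemmas extract from it the functionals that are needed
  to apply the elimination.
\<close>

lemma in_set_concat_map: "x \<in> set xs \<Longrightarrow> y \<in> set (f x) \<Longrightarrow> y \<in> set (concat (map f xs))"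
  by auto

lemma in_set_concat_concat_map:
  "x \<in> set xs \<Longrightarrow> y \<in> set (ys x) \<Longrightarrow> z \<in> set (f x y) \<Longrightarrow>
     z \<in> set (concat (concat (map (\<lambda>x. map (f x) (ys x)) xs)))"
  by auto

lemma DD_corner_functionals:
  assumes "q \<le> m" "\<alpha> \<in> set (M_list m q)"
  shows "set (if \<alpha> = 2 * q
              then [average (corner_dx m c dx dy \<alpha> q) (corner_dy m c dx dy \<alpha> q)]
              else [corner_dx m c dx dy \<alpha> q, corner_dy m c dx dy \<alpha> q])
         \<subseteq> set (cbc_functionals DD_corner m c dx dy yj)"
  unfolding cbc_functionals.simps set_append
  by (intro subsetI UnI2, rule in_set_concat_concat_map[of q _ \<alpha>]) (use assms in auto)

lemma NN_corner_functionals: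
  assumes "q \<le> m" "\<alpha> \<in> set (N_list m q)"
  shows "set (if \<alpha> = 2 * q + 1
              then [average (corner_dx_dy1 m c dx dy \<alpha> q) (corner_dy_dx1 m c dx dy \<alpha> q)]
              else [corner_dx_dy1 m c dx dy \<alpha> q, corner_dy_dx1 m c dx dy \<alpha> q])
         \<subseteq> set (cbc_functionals NN_corner m c dx dy yj)"
  unfolding cbc_functionals.simps set_append
  by (intro subsetI UnI2, rule in_set_concat_concat_map[of q _ \<alpha>]) (use assms in auto)

lemma DN_corner_functionals:
  assumes "q \<le> m"
  shows "set ([corner_dx_dy1 m c dx dy \<alpha> q. \<alpha> \<leftarrow> M_list m q, \<alpha> \<noteq> 2 * q] @
              [corner_dy m c dx dy \<beta> q. \<beta> \<leftarrow> N_list m q, \<beta> \<noteq> 2 * q + 1] @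
              [average (corner_dx_dy1 m c dx dy (2 * q) q) (corner_dy m c dx dy (2 * q + 1) q)])
         \<subseteq> set (cbc_functionals DN_corner m c dx dy yj)"
  unfolding cbc_functionals.simps set_append[of "matching_list _ _"]
  by (intro subsetI UnI2, rule in_set_concat_map[of q]) (use assms in auto)

lemma matching_in_cbc_functionals:
  assumes "\<alpha> \<le> m" "\<beta> \<le> m"
  shows "matching m 1 \<alpha> \<beta> \<in> set (cbc_functionals B m c dx dy yj)"
    and "B \<in> {D_side, N_side} \<Longrightarrow> matching m (-1) \<alpha> \<beta> \<in> set (cbc_functionals B m c dx dy yj)"
proof -
  have in_list: "matching m s \<alpha> \<beta> \<in> set (matching_list m s)" for s
    using assms by (auto simp: set_matching_list)
  show "matching m 1 \<alpha> \<beta> \<in> set (cbc_functionals B m c dx dy yj)"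
    and "B \<in> {D_side, N_side} \<Longrightarrow> matching m (-1) \<alpha> \<beta> \<in> set (cbc_functionals B m c dx dy yj)"
    by (cases B; simp only: cbc_functionals.simps set_append Un_iff in_list simp_thms)
      (auto simp only: cbc_functionals.simps set_append Un_iff in_list)
qed

lemma side_functionals:
  assumes "q \<le> m" "\<alpha> \<le> 2*m+1"
  shows "dirichlet_side m c dx dy yj \<alpha> q \<in> set (cbc_functionals D_side m c dx dy yj)"
    and "neumann_side m c dx dy yj \<alpha> q \<in> set (cbc_functionals N_side m c dx dy yj)"
proof -
  have "q \<in> set [0..<m+1]" "\<alpha> \<in> set [0..<2*m+2]"
    using assms by (auto simp del: upt_Suc)
  then show "dirichlet_side m c dx dy yj \<alpha> q \<in> set (cbc_functionals D_side m c dx dy yj)"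
    and "neumann_side m c dx dy yj \<alpha> q \<in> set (cbc_functionals N_side m c dx dy yj)"
    unfolding cbc_functionals.simps set_append
    by (intro UnI2 in_set_concat_map[of q]; simp only: set_map image_eqI)+
qed

text \<open>
  The five kinds of boundary points are instances of two eliminations: the sides with \<open>p = 0\<close>
  (Dirichlet) and \<open>p = 1\<close> (Neumann), the corners D-D, N-N and D-N with \<open>(px, py)\<close> equal to \<open>(0, 0)\<close>,
  \<open>(1, 1)\<close> and \<open>(0, 1)\<close>.
\<close>

lemma cbc_functionals_injective:
  assumes pos: "c > 0" "dx > 0" "dy > 0"
    and ker: "\<And>F. F \<in> set (cbc_functionals B m c dx dy yj) \<Longrightarrow> F u = 0"
    and l: "l1 \<le> 2*m+1" "l2 \<le> 2*m+1"
  shows "u l1 l2 = 0"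
proof -
  have matching: "matching m 1 \<alpha> \<beta> u = 0" if "\<alpha> \<le> m" "\<beta> \<le> m" for \<alpha> \<beta>
    using that by (intro ker matching_in_cbc_functionals)
  have matching_both: "matching m s \<alpha> \<beta> u = 0"
    if "B \<in> {D_side, N_side}" "s \<in> {1, -1}" "\<alpha> \<le> m" "\<beta> \<le> m" for s \<alpha> \<beta>
    using that matching ker[OF matching_in_cbc_functionals(2)] by auto
  show ?thesis
  proof (cases B)
    case D_side
    show ?thesis
    proof (rule side_determines_coeffs[OF pos _ matching_both])
      show "cbc_derivative m c dx dy q 0 \<alpha> u = 0" if "q \<le> m" "\<alpha> \<le> 2*m+1" for q \<alpha>
        using ker[unfolded D_side, OF side_functionals(1), OF that]
        by (simp only: cbc_functionals_as_derivatives)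
    qed (use l D_side in auto)
  next
    case N_side
    show ?thesis
    proof (rule side_determines_coeffs[OF pos _ matching_both])
      show "cbc_derivative m c dx dy q 1 \<alpha> u = 0" if "q \<le> m" "\<alpha> \<le> 2*m+1" for q \<alpha>
        using ker[unfolded N_side, OF side_functionals(2), OF that]
        by (simp only: cbc_functionals_as_derivatives)
    qed (use l N_side in auto)
  next
    case DD_corner
    note in_set = DD_corner_functionals[THEN subsetD, THEN ker[unfolded DD_corner],
        unfolded cbc_functionals_as_derivatives]
    show ?thesis
    proof (rule corner_determines_coeffs[OF pos _ _ matching])
      fix q \<alpha>
      assume *: "q \<le> m" "\<alpha> \<le> 2*m+1" "\<not> (even (\<alpha> + 0) \<and> \<alpha> \<le> 2*q + 0)"
      then show "cbc_derivative m c dx dy q \<alpha> 0 u = 0"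
        by (intro in_set[of q \<alpha>]) (auto simp: set_M_list)
      from * show "cbc_derivative m c dx dy q 0 \<alpha> u = 0"
        by (intro in_set[of q \<alpha>]) (auto simp: set_M_list)
    next
      fix q assume "q \<le> m"
      then show "average (cbc_derivative m c dx dy q (2*q + 0) 0)
                   (cbc_derivative m c dx dy q 0 (2*q + 0)) u = 0"
        by (rule in_set[of q "2 * q"]; auto simp: set_M_list)
    qed (use l in auto)
  next
    case NN_corner
    note in_set = NN_corner_functionals[THEN subsetD, THEN ker[unfolded NN_corner],
        unfolded cbc_functionals_as_derivatives]
    show ?thesis
    proof (rule corner_determines_coeffs[OF pos _ _ matching])
      fix q \<alpha>
      assume *: "q \<le> m" "\<alpha> \<le> 2*m+1" "\<not> (even (\<alpha> + 1) \<and> \<alpha> \<le> 2*q + 1)"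
      then show "cbc_derivative m c dx dy q \<alpha> 1 u = 0"
        by (intro in_set[of q \<alpha>]) (auto simp: set_N_list)
      from * show "cbc_derivative m c dx dy q 1 \<alpha> u = 0"
        by (intro in_set[of q \<alpha>]) (auto simp: set_N_list)
    next
      fix q assume "q \<le> m"
      then show "average (cbc_derivative m c dx dy q (2*q + 1) 1)
                   (cbc_derivative m c dx dy q 1 (2*q + 1)) u = 0"
        by (rule in_set[of q "2 * q + 1"]; auto simp: set_N_list)
    qed (use l in auto)
  next
    case DN_corner
    note in_set = DN_corner_functionals[THEN subsetD, THEN ker[unfolded DN_corner],
        unfolded cbc_functionals_as_derivatives]
    show ?thesis
    proof (rule corner_determines_coeffs[OF pos _ _ matching])
      fix q \<alpha>
      assume *: "q \<le> m" "\<alpha> \<le> 2*m+1" "\<not> (even (\<alpha> + 0) \<and> \<alpha> \<le> 2*q + 0)"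
      then show "cbc_derivative m c dx dy q \<alpha> 1 u = 0"
        by - (rule in_set, assumption, auto simp: set_M_list)
    next
      fix q \<beta>
      assume "q \<le> m" "\<beta> \<le> 2*m+1" "\<not> (even (\<beta> + 1) \<and> \<beta> \<le> 2*q + 1)"
      then show "cbc_derivative m c dx dy q 0 \<beta> u = 0"
        by - (rule in_set, assumption, auto simp: set_N_list)
    next
      fix q assume "q \<le> m"
      then show "average (cbc_derivative m c dx dy q (2*q + 0) 1)
                   (cbc_derivative m c dx dy q 0 (2*q + 1)) u = 0"
        by - (rule in_set, assumption, auto)
    qed (use l in auto)
  qed
qed

section \<open>The system is square\<close>

lemma distinct_M_list: "distinct (M_list m q)" and distinct_N_list: "distinct (N_list m q)"
  by (simp_all add: M_list_def N_list_def del: upt_Suc)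

text \<open>
  Nonsingularity needs as many conditions as unknowns. A corner has \<open>2 * (2 * m + 2 - q) - 1\<close>
  compatibility conditions for each \<open>q\<close>, the one that is subtracted being lost to the average.
\<close>

lemma length_M_list:
  assumes "q \<le> m + 1"
  shows "length (M_list m q) = 2*m+2 - q"
proof -
  have "set (M_list m q) = {..<2*m+2} - (\<lambda>k. 2 * k) ` {..<q}"
    by (auto simp: M_list_def simp del: upt_Suc)
  moreover have "card ({..<2*m+2} - (\<lambda>k. 2 * k) ` {..<q}) = 2*m+2 - q"
    using assms by (subst card_Diff_subset) (auto simp: card_image inj_on_def)
  ultimately show ?thesis
    by (simp only: distinct_card[OF distinct_M_list, symmetric])
qed

lemma length_N_list:
  assumes "q \<le> m + 1"
  shows "length (N_list m q) = 2*m+2 - q"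
proof -
  have "set (N_list m q) = {..<2*m+2} - (\<lambda>k. 2 * k + 1) ` {..<q}"
    by (auto simp: N_list_def simp del: upt_Suc)
  moreover have "card ({..<2*m+2} - (\<lambda>k. 2 * k + 1) ` {..<q}) = 2*m+2 - q"
    using assms by (subst card_Diff_subset) (auto simp: card_image inj_on_def)
  ultimately show ?thesis
    by (simp only: distinct_card[OF distinct_N_list, symmetric])
qed

lemma sum_list_one_exception:
  fixes j k :: nat
  assumes "distinct xs" "a \<in> set xs"
  shows "(\<Sum>x\<leftarrow>xs. if x = a then j else k) = j + (length xs - 1) * k"
proof -
  have "(\<Sum>x\<leftarrow>xs. if x = a then j else k) = (\<Sum>x\<in>set xs. if x = a then j else k)"
    using assms by (simp add: sum_list_distinct_conv_sum_set)
  also have "\<dots> = j + (\<Sum>x\<in>set xs - {a}. if x = a then j else k)"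
    using assms by (subst sum.remove[of _ a]) auto
  also have "(\<Sum>x\<in>set xs - {a}. if x = a then j else k) = (\<Sum>x\<in>set xs - {a}. k)"
    by (intro sum.cong) auto
  also have "\<dots> = (length xs - 1) * k"
    using assms by (simp add: distinct_card)
  finally show ?thesis .
qed

lemma length_comprehension_skip:
  assumes "distinct xs" "a \<in> set xs"
  shows "length (concat (map (\<lambda>x. if x \<noteq> a then [f x] else []) xs)) = length xs - 1"
proof -
  have "length (concat (map (\<lambda>x. if x \<noteq> a then [f x] else []) xs)) = (\<Sum>x\<leftarrow>xs. if x = a then 0 else 1)"
    by (induction xs) auto
  with assms show ?thesis
    by (simp add: sum_list_one_exception)
qed

lemma length_concat_concat_map:
  "length (concat (concat (map (\<lambda>x. map (f x) (ys x)) xs))) = (\<Sum>x\<leftarrow>xs. \<Sum>y\<leftarrow>ys x. length (f x y))"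
  by (induction xs) (auto simp: length_concat comp_def)

lemma sum_corner_conditions:
  "n \<le> m + 1 \<Longrightarrow> (\<Sum>q\<leftarrow>[0..<n]. 1 + (2*m+1 - q) * 2) = n * (4*m+4 - n)"
proof (induction n)
  case (Suc n)
  then obtain d where "m = n + d"
    using le_Suc_ex by auto
  with Suc show ?case
    by (simp add: algebra_simps)
qed simp

lemma length_matching_list: "length (matching_list m s) = (m + 1)\<^sup>2"
  by (simp add: matching_list_def length_concat comp_def sum_list_triv power2_eq_square del: upt_Suc)

lemma length_cbc_functionals: "length (cbc_functionals B m c dx dy yj) = 4 * (m + 1)\<^sup>2"
proof -
  have M: "distinct (M_list m q)" "2 * q \<in> set (M_list m q)" "length (M_list m q) - 1 = 2*m+1 - q"
    and N: "distinct (N_list m q)" "2 * q + 1 \<in> set (N_list m q)" "length (N_list m q) - 1 = 2*m+1 - q"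
    if "q \<in> set [0..<m+1]" for q
    using that by (auto simp: length_M_list length_N_list set_M_list set_N_list distinct_M_list
        distinct_N_list simp del: upt_Suc)
  have corner: "(\<Sum>q\<leftarrow>[0..<m+1]. h q) = 3 * (m + 1)\<^sup>2"
    if "\<And>q. q \<in> set [0..<m+1] \<Longrightarrow> h q = 1 + (2*m+1 - q) * 2" for h
  proof -
    have "(\<Sum>q\<leftarrow>[0..<m+1]. h q) = (\<Sum>q\<leftarrow>[0..<m+1]. 1 + (2*m+1 - q) * 2)"
      using that by (intro arg_cong[where f = sum_list] map_cong refl)
    also have "\<dots> = 3 * (m + 1)\<^sup>2"
      using sum_corner_conditions[of "m + 1" m] by (simp add: power2_eq_square algebra_simps del: upt_Suc)
    finally show ?thesis .
  qed
  show ?thesis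
  proof (cases B)
    case DD_corner
    have "(\<Sum>\<alpha>\<leftarrow>M_list m q. if \<alpha> = 2 * q then Suc 0 else Suc (Suc 0)) = 1 + (2*m+1 - q) * 2"
      if "q \<in> set [0..<m+1]" for q
      using M[OF that] by (simp add: sum_list_one_exception)
    from corner[OF this] show ?thesis
      by (simp add: DD_corner length_matching_list length_concat_concat_map if_distrib[of length]
          del: upt_Suc cong: if_cong)
  next
    case NN_corner
    have "(\<Sum>\<alpha>\<leftarrow>N_list m q. if \<alpha> = 2 * q + 1 then Suc 0 else Suc (Suc 0)) = 1 + (2*m+1 - q) * 2"
      if "q \<in> set [0..<m+1]" for q
      using N[OF that] by (simp add: sum_list_one_exception)
    from corner[OF this] show ?thesis
      by (simp add: NN_corner length_matching_list length_concat_concat_map if_distrib[of length]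
          del: upt_Suc cong: if_cong)
  next
    case DN_corner
    show ?thesis
      unfolding DN_corner cbc_functionals.simps length_append[of "matching_list _ _"]
        length_matching_list length_concat map_map comp_def
    proof (subst corner)
      fix q assume q: "q \<in> set [0..<m+1]"
      note skip = length_comprehension_skip[OF M(1,2)[OF q]] length_comprehension_skip[OF N(1,2)[OF q]]
        M(3)[OF q] N(3)[OF q]
      show "length ([corner_dx_dy1 m c dx dy \<alpha> q. \<alpha> \<leftarrow> M_list m q, \<alpha> \<noteq> 2 * q] @
              [corner_dy m c dx dy \<beta> q. \<beta> \<leftarrow> N_list m q, \<beta> \<noteq> 2 * q + 1] @
              [average (corner_dx_dy1 m c dx dy (2 * q) q) (corner_dy m c dx dy (2 * q + 1) q)])
            = 1 + (2*m+1 - q) * 2"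
        unfolding length_append skip by simp
    qed simp
  next
    case D_side
    show ?thesis
      unfolding D_side cbc_functionals.simps length_append length_matching_list length_concat map_map
        comp_def length_map length_upt sum_list_triv
      by (simp add: power2_eq_square)
  next
    case N_side
    show ?thesis
      unfolding N_side cbc_functionals.simps length_append length_matching_list length_concat map_map
        comp_def length_map length_upt sum_list_triv
      by (simp add: power2_eq_square)
  qed
qed

section \<open>Linearity and homogeneity\<close>

text \<open>
  Arrays are plain functions, so their sums and multiples are formed entrywise.
\<close>

definition linear_functional :: "functional \<Rightarrow> bool" where
  "linear_functional F \<longleftrightarrow>
     (\<forall>u v. F (\<lambda>i j. u i j + v i j) = F u + F v) \<and> (\<forall>r u. F (\<lambda>i j. r * u i j) = r * F u)"

lemma linear_functional_sum:
  fixes n :: nat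
  assumes "linear_functional F"
  shows "F (\<lambda>i j. \<Sum>k<n. r k * U k i j) = (\<Sum>k<n. r k * F (U k))"
proof (induction n)
  case 0
  have "\<forall>r u. F (\<lambda>i j. r * u i j) = r * F u"
    using assms unfolding linear_functional_def by blast
  from this[rule_format, of 0 "\<lambda>i j. 0"] show ?case
    by simp
next
  case (Suc n)
  have "F (\<lambda>i j. \<Sum>k<Suc n. r k * U k i j)
        = F (\<lambda>i j. \<Sum>k<n. r k * U k i j) + F (\<lambda>i j. r n * U n i j)"
    using assms unfolding linear_functional_def by simp
  also have "F (\<lambda>i j. r n * U n i j) = r n * F (U n)"
    using assms unfolding linear_functional_def by blast
  finally show ?case
    using Suc by simp
qed

lemma linear_functional_matching: "linear_functional (matching m s \<alpha> \<beta>)"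
  unfolding linear_functional_def matching_def
  by (simp add: algebra_simps sum.distrib sum_distrib_left del: sum.cl_ivl_Suc)

lemma linear_functional_cbc_derivative: "linear_functional (cbc_derivative m c dx dy q p r)"
proof -
  have "grid_jet m dx dy (\<lambda>i j. u i j + v i j) = (\<lambda>i j. grid_jet m dx dy u i j + grid_jet m dx dy v i j)"
    and "grid_jet m dx dy (\<lambda>i j. k * u i j) = (\<lambda>i j. k * grid_jet m dx dy u i j)" for u v k
    by (auto simp: fun_eq_iff grid_jet_def field_simps add_divide_distrib)
  then show ?thesis
    unfolding linear_functional_def cbc_derivative_def laplace_jet_def
    by (simp add: algebra_simps sum.distrib sum_distrib_left)
qed

lemma linear_functional_average:
  "linear_functional F \<Longrightarrow> linear_functional G \<Longrightarrow> linear_functional (average F G)"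
  by (simp add: linear_functional_def average_def field_simps)

text \<open>
  Every derivative in \<open>\<partial>\<^sub>x\<^sup>p \<partial>\<^sub>y\<^sup>r \<Delta>\<^sup>q\<close> has total order \<open>p + r + 2 * q\<close>. Changing both mesh widths by
  the same factor therefore multiplies the whole functional by a power of that factor, and what
  remains depends on the ratio alone.
\<close>

lemma cbc_derivative_scaling:
  assumes "dy > 0"
  shows "cbc_derivative m c dx dy q p r u =
         c ^ (2 * q) / dy ^ (p + r + 2 * q) * cbc_derivative m 1 (dx / dy) 1 q p r u"
proof -
  have jet: "grid_jet m dx dy u i j = grid_jet m (dx / dy) 1 u i j / dy ^ (i + j)" for i j
    using assms by (simp add: grid_jet_def power_divide power_add)
  have "laplace_jet q p r (grid_jet m dx dy u) =
        laplace_jet q p r (grid_jet m (dx / dy) 1 u) / dy ^ (p + r + 2 * q)"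
    unfolding laplace_jet_def sum_divide_distrib
  proof (rule sum.cong[OF refl])
    fix k assume "k \<in> {..q}"
    then have "p + 2 * (q - k) + (r + 2 * k) = p + r + 2 * q"
      by auto
    then show "real (q choose k) * grid_jet m dx dy u (p + 2 * (q - k)) (r + 2 * k) =
        real (q choose k) * grid_jet m (dx / dy) 1 u (p + 2 * (q - k)) (r + 2 * k) / dy ^ (p + r + 2 * q)"
      by (simp only: jet times_divide_eq_right)
  qed
  then show ?thesis
    by (simp add: cbc_derivative_def)
qed

lemma list_all2_concat_map:
  "(\<And>x. x \<in> set xs \<Longrightarrow> list_all2 R (f x) (g x)) \<Longrightarrow>
     list_all2 R (concat (map f xs)) (concat (map g xs))"
  by (induction xs) (auto intro: list_all2_appendI)

lemma list_all2_concat_concat_map: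
  "(\<And>x y. x \<in> set xs \<Longrightarrow> y \<in> set (ys x) \<Longrightarrow> list_all2 R (f x y) (g x y)) \<Longrightarrow>
     list_all2 R (concat (concat (map (\<lambda>x. map (f x) (ys x)) xs)))
                 (concat (concat (map (\<lambda>x. map (g x) (ys x)) xs)))"
  by (induction xs) (auto intro: list_all2_appendI list_all2_concat_map)

text \<open>
  Linearity of the rows and their behaviour under scaling are both statements about corresponding
  entries of lists of functionals, so the recursion over the lists is done once, for an arbitrary
  relation. An average is only ever taken of two derivatives of the same total order; the averages
  would not be homogeneous otherwise.
\<close>

lemma cbc_functionals_relate:
  assumes matching: "\<And>s \<alpha> \<beta>. R (matching m s \<alpha> \<beta>) (matching m s \<alpha> \<beta>)"
    and derivative: "\<And>q p r. R (cbc_derivative m c dx dy q p r) (cbc_derivative m c' dx' dy' q p r)"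
    and average: "\<And>q p r p' r'. p + r = p' + r' \<Longrightarrow>
           R (average (cbc_derivative m c dx dy q p r) (cbc_derivative m c dx dy q p' r'))
             (average (cbc_derivative m c' dx' dy' q p r) (cbc_derivative m c' dx' dy' q p' r'))"
  shows "list_all2 R (cbc_functionals B m c dx dy yj) (cbc_functionals B m c' dx' dy' yj')"
proof -
  have "list_all2 R (matching_list m s) (matching_list m s)" for s
    by (auto simp: list_all2_same matching_list_def matching simp del: upt_Suc)
  note intros = this list_all2_appendI list_all2_concat_map list_all2_concat_concat_map
  note unfold = cbc_functionals.simps cbc_functionals_as_derivatives
  note close = list.rel_map list_all2_same derivative average
  show ?thesis
  proof (cases B)
    case D_side
    show ?thesis
      by (simp only: D_side unfold, intro intros) (auto simp: close simp del: upt_Suc)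
  next
    case N_side
    show ?thesis
      by (simp only: N_side unfold, intro intros) (auto simp: close simp del: upt_Suc)
  next
    case DD_corner
    show ?thesis
      by (simp only: DD_corner unfold, intro intros) (auto simp: close simp del: upt_Suc)
  next
    case NN_corner
    show ?thesis
      by (simp only: NN_corner unfold, intro intros) (auto simp: close simp del: upt_Suc)
  next
    case DN_corner
    show ?thesis
      by (simp only: DN_corner unfold, intro intros) (auto simp: close simp del: upt_Suc)
  qed
qed

section \<open>From functionals to matrices\<close>

lemma invertible_mat_if_trivial_kernel:
  fixes A :: "real mat"
  assumes A: "A \<in> carrier_mat n n"
    and ker: "\<And>v. v \<in> carrier_vec n \<Longrightarrow> A *\<^sub>v v = 0\<^sub>v n \<Longrightarrow> v = 0\<^sub>v n"
  shows "invertible_mat A"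
proof -
  have "det A \<noteq> 0"
    using ker det_0_iff_vec_prod_zero_field[OF A] by blast
  then have "A \<in> Units (ring_mat TYPE(real) n ())"
    using A by (intro det_non_zero_imp_unit)
  then obtain B where "B \<in> carrier_mat n n" "B * A = 1\<^sub>m n" "A * B = 1\<^sub>m n"
    by (auto simp: Units_def ring_mat_def)
  with A show ?thesis
    unfolding invertible_mat_def inverts_mat_def by (auto simp: square_mat.simps)
qed

lemma cbc_matrix_carrier: "cbc_matrix B m c dx dy yj \<in> carrier_mat (4 * (m + 1)\<^sup>2) (4 * (m + 1)\<^sup>2)"
  by (simp add: cbc_matrix_def Let_def length_cbc_functionals)

text \<open>
  The matrix-vector product evaluates the functionals at the array whose entries are those of the
  vector, so the kernel is trivial.
\<close>

lemma cbc_matrix_invertible: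
  assumes pos: "c > 0" "dx > 0" "dy > 0"
  shows "invertible_mat (cbc_matrix B m c dx dy yj)"
proof (rule invertible_mat_if_trivial_kernel[OF cbc_matrix_carrier])
  let ?Fs = "cbc_functionals B m c dx dy yj"
  define N where "N = 2*m+2"
  define n where "n = 4 * (m + 1)\<^sup>2"
  have n: "n = N * N"
    by (simp add: n_def N_def power2_eq_square algebra_simps)
  have "N > 0"
    by (simp add: N_def)
  have len: "length ?Fs = n"
    unfolding n_def by (rule length_cbc_functionals)
  fix v :: "real Matrix.vec"
  assume v: "v \<in> carrier_vec (4 * (m + 1)\<^sup>2)"
    and ker: "cbc_matrix B m c dx dy yj *\<^sub>v v = 0\<^sub>v (4 * (m + 1)\<^sup>2)"
  have dim_v: "dim_vec v = n"
    using v by (simp add: n_def)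
  define u where "u l1 l2 = (\<Sum>k<n. vec_index v k * unit_coeffs (k div N) (k mod N) l1 l2)" for l1 l2
  have matrix: "cbc_matrix B m c dx dy yj =
      Matrix.mat n n (\<lambda>(i, j). (?Fs ! i) (unit_coeffs (j div N) (j mod N)))"
    by (simp only: cbc_matrix_def Let_def len n_def N_def)
  have "F u = 0" if "F \<in> set ?Fs" for F
  proof -
    from that obtain i where i: "i < n" "F = ?Fs ! i"
      by (auto simp: in_set_conv_nth len)
    have "list_all2 (\<lambda>F _. linear_functional F) ?Fs ?Fs"
      by (intro cbc_functionals_relate linear_functional_matching linear_functional_cbc_derivative
          linear_functional_average)
    then have "linear_functional F"
      using that by (auto simp: list_all2_same)
    then have "F u = (\<Sum>k<n. vec_index v k * F (unit_coeffs (k div N) (k mod N)))"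
      unfolding u_def by (rule linear_functional_sum)
    also have "\<dots> = vec_index (cbc_matrix B m c dx dy yj *\<^sub>v v) i"
      using i by (simp add: matrix scalar_prod_def dim_v lessThan_atLeast0 mult.commute)
    also have "\<dots> = 0"
      using ker i by (simp add: n_def)
    finally show ?thesis .
  qed
  then have u_zero: "u l1 l2 = 0" if "l1 \<le> 2*m+1" "l2 \<le> 2*m+1" for l1 l2
    using cbc_functionals_injective[OF pos] that by blast
  have "vec_index v k = 0" if "k < n" for k
  proof -
    have "k div N \<le> 2*m+1" "k mod N \<le> 2*m+1"
      using that \<open>N > 0\<close> less_mult_imp_div_less[of k N N] mod_less_divisor[of N k]
      unfolding n by (auto simp: N_def)
    then have "0 = u (k div N) (k mod N)"
      by (simp add: u_zero)
    also have "\<dots> = (\<Sum>k'<n. if k' = k then vec_index v k' else 0)"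
      unfolding u_def unit_coeffs_def
    proof (intro sum.cong refl)
      fix k'
      have "k div N = k' div N \<and> k mod N = k' mod N \<longleftrightarrow> k' = k"
        by (metis div_mult_mod_eq)
      then show "vec_index v k' * (if k div N = k' div N \<and> k mod N = k' mod N then 1 else 0) =
            (if k' = k then vec_index v k' else 0)"
        by simp
    qed
    finally show ?thesis
      using that by simp
  qed
  then show "v = 0\<^sub>v (4 * (m + 1)\<^sup>2)"
    using v by (intro eq_vecI) (auto simp: n_def)
qed

text \<open>
  Row scaling forgets a positive factor in each row: the entry of largest absolute value carries the
  same factor. This includes a zero row, where both sides divide by zero.
\<close>

lemma row_scale_cong:
  assumes dims: "dim_row A = dim_row B" "dim_col A = dim_col B"
    and rows: "\<And>i. i < dim_row A \<Longrightarrow> \<exists>k>0. \<forall>j<dim_col A. A $$ (i, j) = k * B $$ (i, j)"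
  shows "row_scale A = row_scale B"
proof (rule eq_matI)
  fix i j assume "i < dim_row (row_scale B)" "j < dim_col (row_scale B)"
  then have i: "i < dim_row A" and j: "j < dim_col A"
    by (simp_all add: row_scale_def dims)
  from rows[OF i] obtain k where k: "k > 0" "\<And>j. j < dim_col A \<Longrightarrow> A $$ (i, j) = k * B $$ (i, j)"
    by blast
  let ?R = "(\<lambda>j. \<bar>B $$ (i, j)\<bar>) ` {..<dim_col A}"
  have "(\<lambda>j. \<bar>A $$ (i, j)\<bar>) ` {..<dim_col A} = (*) k ` ?R"
    using k by (simp add: image_image abs_mult cong: image_cong_simp)
  also have "Max ((*) k ` ?R) = k * Max ?R"
    using k j by (intro mono_Max_commute[symmetric]) (auto intro!: monoI)
  finally have "Max ((\<lambda>j. \<bar>A $$ (i, j)\<bar>) ` {..<dim_col A}) = k * Max ?R" .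
  with k i j show "row_scale A $$ (i, j) = row_scale B $$ (i, j)"
    by (simp add: row_scale_def flip: dims)
qed (simp_all add: row_scale_def dims)

text \<open>
  The speed \<open>c\<close> and the overall mesh size enter each row through a single positive factor, and \<open>yj\<close> not at
  all because the polynomial is centred there. Hence the row-scaled matrix itself, not merely its
  condition number, is that of the system with \<open>c = 1\<close> and mesh widths \<open>dx / dy\<close> and 1.
\<close>

lemma row_scale_cbc_matrix:
  assumes "c > 0" "dy > 0"
  shows "row_scale (cbc_matrix B m c dx dy yj) = row_scale (cbc_matrix B m 1 (dx / dy) 1 0)"
proof (rule row_scale_cong)
  define R :: "functional \<Rightarrow> functional \<Rightarrow> bool" where "R F G \<longleftrightarrow> (\<exists>k>0. \<forall>u. F u = k * G u)" for F G
  have factor: "c ^ (2 * q) / dy ^ d > 0" for q d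
    using assms by simp
  have rel: "list_all2 R (cbc_functionals B m c dx dy yj) (cbc_functionals B m 1 (dx / dy) 1 0)"
  proof (rule cbc_functionals_relate)
    show "R (matching m s \<alpha> \<beta>) (matching m s \<alpha> \<beta>)" for s \<alpha> \<beta>
      unfolding R_def by (rule exI[of _ 1]) simp
    show "R (cbc_derivative m c dx dy q p r) (cbc_derivative m 1 (dx / dy) 1 q p r)" for q p r
      unfolding R_def using factor cbc_derivative_scaling[OF assms(2)] by blast
    show "R (average (cbc_derivative m c dx dy q p r) (cbc_derivative m c dx dy q p' r'))
            (average (cbc_derivative m 1 (dx / dy) 1 q p r) (cbc_derivative m 1 (dx / dy) 1 q p' r'))"
      if "p + r = p' + r'" for q p r p' r'
    proof -
      \<comment> \<open>Both halves of the average scale by this factor, as their total orders agree.\<close>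
      define k where "k = c ^ (2 * q) / dy ^ (p + r + 2 * q)"
      have "cbc_derivative m c dx dy q p r u = k * cbc_derivative m 1 (dx / dy) 1 q p r u"
        and "cbc_derivative m c dx dy q p' r' u = k * cbc_derivative m 1 (dx / dy) 1 q p' r' u" for u
        unfolding k_def using cbc_derivative_scaling[OF assms(2)] that by metis+
      moreover have "k > 0"
        unfolding k_def by (rule factor)
      ultimately show ?thesis
        unfolding R_def average_def by (intro exI[of _ k]) (simp add: distrib_left)
    qed
  qed
  fix i assume "i < dim_row (cbc_matrix B m c dx dy yj)"
  then have i: "i < 4 * (m + 1)\<^sup>2"
    by (simp only: carrier_matD(1)[OF cbc_matrix_carrier])
  with rel have "R (cbc_functionals B m c dx dy yj ! i) (cbc_functionals B m 1 (dx / dy) 1 0 ! i)"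
    by (auto simp: list_all2_conv_all_nth length_cbc_functionals)
  with i show "\<exists>k>0. \<forall>j<dim_col (cbc_matrix B m c dx dy yj).
      cbc_matrix B m c dx dy yj $$ (i, j) = k * cbc_matrix B m 1 (dx / dy) 1 0 $$ (i, j)"
    unfolding R_def by (auto simp: cbc_matrix_def Let_def length_cbc_functionals)
qed (simp_all add: cbc_matrix_def Let_def length_cbc_functionals)

theorem theorem1:
  fixes m :: nat and B :: boundary_kind
  assumes "m \<in> {1, 2, 3, 4}"
  shows "(\<forall>c dx dy yj :: real. c > 0 \<and> dx > 0 \<and> dy > 0 \<longrightarrow>
            invertible_mat (cbc_matrix B m c dx dy yj))
       \<and> (\<exists>K :: real \<Rightarrow> real. \<forall>c dx dy yj :: real. c > 0 \<and> dx > 0 \<and> dy > 0 \<longrightarrow>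
            cond_inf (row_scale (cbc_matrix B m c dx dy yj)) = K (dx / dy))"
proof (intro conjI exI allI impI)
  fix c dx dy yj :: real assume pos: "c > 0 \<and> dx > 0 \<and> dy > 0"
  then show "invertible_mat (cbc_matrix B m c dx dy yj)"
    by (intro cbc_matrix_invertible) auto
  from pos show "cond_inf (row_scale (cbc_matrix B m c dx dy yj)) =
        (\<lambda>\<gamma>. cond_inf (row_scale (cbc_matrix B m 1 \<gamma> 1 0))) (dx / dy)"
    by (simp add: row_scale_cbc_matrix[of c dy])
qed

end
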